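(* Let $r\ge 1$ and $t\ge 2$ be fixed integers. As $s\to\infty$, the probability generating function $\sum_{n\ge 0}\mathbb{P}(|\mathrm{core}_t(\lambda)|=n)\,z^n$ of the size of the $t$-core of a uniformly random partition $\lambda\in\mathcal{P}_{r,s}$ converges, coefficient by coefficient in $z$, to $$\phi(z)=\sum_{\rho\in\mathcal{P}^t_{r,rt}}\frac{z^{|\rho|}}{t^r}\binom{r}{a_0,\dots,a_{t-1}},$$ where $\mathcal{P}^t_{r,rt}$ is the set of $t$-cores in $\mathcal{P}_{r,rt}$ and, for each $\rho\in\mathcal{P}^t_{r,rt}$, $a_i=|v^i|$ for all $i$, with $(v^0,\dots,v^{t-1})$ the $t$-tuple of binary words associated to $\rho$ as a partition in $\mathcal{P}_{r,rt}$.
   Context: A partition $\lambda=(\lambda_1\ge\lambda_2\ge\cdots)$ is a weakly decreasing finite sequence of positive integers (possibly empty), extended by $\lambda_j=0$ for $j>\ell(\lambda)$, where $\ell(\lambda)$ is the number of parts; $|\lambda|=\sum_j\lambda_j$. $\mathcal{P}_{r,s}$ is the set of partitions with $\ell(\lambda)\le r$ and $\lambda_1\le s$. A rim-hook of $\lambda$ is a connected skew shape $\lambda/\mu$ (with $\mu\subseteq\lambda$ a partition) containing no $2\times2$ block of boxes; a $t$-rim hook is one with exactly $t$ boxes. The $t$-core $\mathrm{core}_t(\lambda)$ is the partition obtained by successively removing $t$-rim hooks until none can be removed (it does not depend on the order of removals); $\lambda$ is a $t$-core if $\mathrm{core}_t(\lambda)=\lambda$. Words associated to a partition $\lambda\in\mathcal{P}_{r,s}$: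 the balanced abacus of $\lambda$ is the word $w=(w_m)_{m\in\mathbb{Z}}$ in $\{0,1\}$ with $w_m=1$ if $m=\lambda_j-j$ for some $j\ge1$ and $w_m=0$ otherwise (equivalently, it traces the boundary of $\lambda$ with $1$ for an up step and $0$ for a right step, normalised so that $|\{m\ge0: w_m=1\}|=|\{m<0:w_m=0\}|$). With $n_i=\left\lfloor\frac{r+s+t-1-i}{t}\right\rfloor$, set $$v^i=(w_{-r+i},\,w_{-r+i+t},\,\dots,\,w_{-r+i+t(n_i-1)}),\qquad 0\le i\le t-1.$$ In the claim this is applied with $s=rt$. For a binary word $v$, $|v|$ denotes the number of $1$'s in $v$. $\binom{r}{a_0,\dots,a_{t-1}}=\frac{r!}{a_0!\cdots a_{t-1}!}$ is the multinomial coefficient. *)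

theory Defs
  imports
    "HOL-Probability.Probability"
    "HOL-Computational_Algebra.Formal_Power_Series"
begin

definition is_partition :: "nat list \<Rightarrow> bool" where
  "is_partition l \<longleftrightarrow> sorted_wrt (\<ge>) l \<and> (\<forall>x\<in>set l. x > 0)"

text \<open>Parts are numbered from \<open>1\<close>, as in the usual notation; \<open>part l 0\<close> is never used.\<close>

definition part :: "nat list \<Rightarrow> nat \<Rightarrow> nat" where
  "part l j = (if 1 \<le> j \<and> j \<le> length l then l ! (j - 1) else 0)"

definition partitions_in_box :: "nat \<Rightarrow> nat \<Rightarrow> nat list set" where
  "partitions_in_box r s = {l. is_partition l \<and> length l \<le> r \<and> part l 1 \<le> s}"

definition diagram :: "nat list \<Rightarrow> (nat \<times> nat) set" where
  "diagram l = {(i, j). 1 \<le> i \<and> i \<le> length l \<and> 1 \<le> j \<and> j \<le> part l i}"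

text \<open>Two boxes are adjacent if they share an edge.\<close>

definition adjacent_boxes :: "nat \<times> nat \<Rightarrow> nat \<times> nat \<Rightarrow> bool" where
  "adjacent_boxes b c \<longleftrightarrow>
     (fst b = fst c \<and> (snd b = Suc (snd c) \<or> snd c = Suc (snd b))) \<or>
     (snd b = snd c \<and> (fst b = Suc (fst c) \<or> fst c = Suc (fst b)))"

definition connected_boxes :: "(nat \<times> nat) set \<Rightarrow> bool" where
  "connected_boxes S \<longleftrightarrow>
     (\<forall>b\<in>S. \<forall>c\<in>S. (\<lambda>x y. x \<in> S \<and> y \<in> S \<and> adjacent_boxes x y)\<^sup>*\<^sup>* b c)"

definition has_2x2_block :: "(nat \<times> nat) set \<Rightarrow> bool" where
  "has_2x2_block S \<longleftrightarrow> (\<exists>i j. {(i, j), (i, Suc j), (Suc i, j), (Suc i, Suc j)} \<subseteq> S)"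

definition rim_hook :: "nat list \<Rightarrow> nat list \<Rightarrow> bool" where
  "rim_hook l m \<longleftrightarrow> is_partition l \<and> is_partition m \<and> diagram m \<subseteq> diagram l \<and>
     connected_boxes (diagram l - diagram m) \<and> \<not> has_2x2_block (diagram l - diagram m)"

definition remove_rim_hook :: "nat \<Rightarrow> nat list \<Rightarrow> nat list \<Rightarrow> bool" where
  "remove_rim_hook t l m \<longleftrightarrow> rim_hook l m \<and> card (diagram l - diagram m) = t"

text \<open>The description below determines a unique partition for \<open>t \<ge> 1\<close>, because the final result of
  removing \<open>t\<close>-rim hooks does not depend on the order of the removals.\<close>

definition core :: "nat \<Rightarrow> nat list \<Rightarrow> nat list" where
  "core t l = (THE m. (remove_rim_hook t)\<^sup>*\<^sup>* l m \<and> (\<nexists>k. remove_rim_hook t m k))"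

definition cores_in_box :: "nat \<Rightarrow> nat \<Rightarrow> nat \<Rightarrow> nat list set" where
  "cores_in_box t r s = {l \<in> partitions_in_box r s. core t l = l}"

definition abacus :: "nat list \<Rightarrow> int \<Rightarrow> nat" where
  "abacus l m = (if \<exists>j\<ge>1. m = int (part l j) - int j then 1 else 0)"

definition word_length :: "nat \<Rightarrow> nat \<Rightarrow> nat \<Rightarrow> nat \<Rightarrow> nat" where
  "word_length t r s i = (r + s + t - 1 - i) div t"

definition abacus_word :: "nat \<Rightarrow> nat \<Rightarrow> nat \<Rightarrow> nat list \<Rightarrow> nat \<Rightarrow> nat list" where
  "abacus_word t r s l i =
     map (\<lambda>k. abacus l (- int r + int i + int t * int k)) [0..<word_length t r s i]"

definition ones :: "nat list \<Rightarrow> nat" where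
  "ones v = count_list v 1"

definition multinomial :: "nat \<Rightarrow> nat \<Rightarrow> (nat \<Rightarrow> nat) \<Rightarrow> real" where
  "multinomial r t a = fact r / (\<Prod>i<t. fact (a i))"

definition core_size_pgf :: "nat \<Rightarrow> nat \<Rightarrow> nat \<Rightarrow> real fps" where
  "core_size_pgf t r s =
     Abs_fps (\<lambda>n. measure_pmf.prob (pmf_of_set (partitions_in_box r s)) {l. sum_list (core t l) = n})"

definition limit_pgf :: "nat \<Rightarrow> nat \<Rightarrow> real fps" where
  "limit_pgf t r =
     (\<Sum>\<rho>\<in>cores_in_box t r (r * t).
        fps_const (multinomial r t (\<lambda>i. ones (abacus_word t r (r * t) \<rho> i)) / real t ^ r)
          * fps_X ^ sum_list \<rho>)"

text \<open>Hence \<^term>\<open>pmf_of_set (partitions_in_box r s)\<close> is the uniform distribution, and the sum in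
  \<^const>\<open>limit_pgf\<close> is finite.\<close>

lemma finite_partitions_in_box: "finite (partitions_in_box r s)"
proof (rule finite_subset)
  show "partitions_in_box r s \<subseteq> {l. set l \<subseteq> {..s} \<and> length l \<le> r}"
  proof
    fix l assume l: "l \<in> partitions_in_box r s"
    have "x \<le> s" if "x \<in> set l" for x
      using l that by (cases l) (auto simp: partitions_in_box_def is_partition_def part_def)
    with l show "l \<in> {l. set l \<subseteq> {..s} \<and> length l \<le> r}"
      by (auto simp: partitions_in_box_def)
  qed
qed (simp add: finite_lists_length_le)

lemma partitions_in_box_nonempty: "partitions_in_box r s \<noteq> {}"
proof -
  have "[] \<in> partitions_in_box r s"
    by (simp add: partitions_in_box_def is_partition_def part_def)
  then show ?thesis by blast
qed

lemma finite_cores_in_box: "finite (cores_in_box t r s)"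
  using finite_partitions_in_box[of r s] by (simp add: cores_in_box_def)

end

theory Submission
  imports Defs
begin

text \<open>A partition with at most \<open>r\<close> parts is encoded by its set of \<open>r\<close> beads \<open>\<lambda>\<^sub>j + r - j\<close>. Removing a
  \<open>t\<close>-rim hook moves one bead from \<open>x\<close> to the vacant position \<open>x - t\<close>, so it preserves the number
  \<open>a\<^sub>i\<close> of beads in each residue class modulo \<open>t\<close>, and the \<open>t\<close>-core is the configuration with these
  numbers in which every runner is pushed down. Hence exactly \<open>\<Prod>\<^sub>i (n\<^sub>i choose a\<^sub>i)\<close> of the
  \<open>(r + s) choose r\<close> partitions in the box have a given core, where \<open>n\<^sub>i \<sim> s / t\<close> is the number of
  positions on the \<open>i\<close>-th runner. Dividing numerator and denominator by \<open>(r + s) ^ r\<close> gives the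
  limiting probability of each core, and only finitely many cores occur.\<close>

section \<open>Partitions and ribbons\<close>

lemma part_0 [simp]: "part l 0 = 0"
  by (simp add: part_def)

lemma part_beyond: "length l < j \<Longrightarrow> part l j = 0"
  by (simp add: part_def)

lemma part_antimono:
  assumes "is_partition l" "1 \<le> i" "i \<le> j"
  shows "part l j \<le> part l i"
proof (cases "i < j \<and> j \<le> length l")
  case True
  then have "i - 1 < j - 1" "j - 1 < length l" using assms(2) by auto
  then have "l ! (j - 1) \<le> l ! (i - 1)"
    using assms(1) by (auto simp: is_partition_def sorted_wrt_iff_nth_less)
  then show ?thesis using True assms by (auto simp: part_def)
next
  case False
  then show ?thesis using assms by (cases "i = j") (auto simp: part_def)
qed

lemma part_pos_iff: "is_partition l \<Longrightarrow> 0 < part l j \<longleftrightarrow> 1 \<le> j \<and> j \<le> length l"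
  by (auto simp: part_def is_partition_def)

lemma partition_eqI:
  assumes "is_partition l" "is_partition m" and eq: "\<And>j. part l j = part m j"
  shows "l = m"
proof (rule nth_equalityI)
  have "1 \<le> j \<and> j \<le> length l \<longleftrightarrow> 1 \<le> j \<and> j \<le> length m" for j
    using part_pos_iff[OF assms(1), of j] part_pos_iff[OF assms(2), of j] eq[of j] by metis
  then show len: "length l = length m"
    by (metis le_antisym linorder_not_le nat_le_linear less_one)
  fix i assume "i < length l"
  then show "l ! i = m ! i"
    using eq[of "Suc i"] len by (simp add: part_def)
qed

text \<open>Shapes below are prescribed by their row lengths. The list stops before the first
  vanishing row, which keeps all its entries positive; \<open>f 0 = 0\<close> matches the convention
  for \<open>part\<close>.\<close>

lemma partition_of_parts:
  assumes anti: "\<And>i j. 1 \<le> i \<Longrightarrow> i \<le> j \<Longrightarrow> f j \<le> f i"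
    and "f 0 = 0" and zero: "\<And>j. r < j \<Longrightarrow> f j = 0"
  obtains m where "is_partition m" "length m \<le> r" "part m = f"
proof
  define n where "n = (LEAST n. f (Suc n) = 0)"
  have n0: "f (Suc n) = 0"
    unfolding n_def by (rule LeastI[of _ r]) (simp add: zero)
  have pos: "0 < f j" if "1 \<le> j" "j \<le> n" for j
    using not_less_Least[of "j - 1" "\<lambda>n. f (Suc n) = 0"] that by (auto simp: n_def)
  let ?m = "map f [1..<Suc n]"
  show "is_partition ?m"
    using pos anti by (auto simp: is_partition_def sorted_wrt_iff_nth_less simp del: upt_Suc)
  have "n \<le> r"
    unfolding n_def by (rule Least_le) (simp add: zero)
  then show "length ?m \<le> r" by simp
  show "part ?m = f"
  proof
    fix j
    have "f j = 0" if "n < j" using anti[of "Suc n" j] n0 that by simp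
    then show "part ?m j = f j"
      using \<open>f 0 = 0\<close> by (cases "j = 0") (auto simp: part_def simp del: upt_Suc)
  qed
qed

section \<open>Diagrams and skew shapes in terms of row lengths\<close>

lemma mem_diagram_iff: "(i, j) \<in> diagram l \<longleftrightarrow> 1 \<le> j \<and> j \<le> part l i"
  by (auto simp: diagram_def part_def split: if_splits)

lemma finite_diagram [simp]: "finite (diagram l)"
proof (rule finite_subset)
  show "diagram l \<subseteq> Sigma {..length l} (\<lambda>i. {..part l i})"
    by (auto simp: diagram_def)
qed auto

lemma diagram_subset_iff: "diagram m \<subseteq> diagram l \<longleftrightarrow> (\<forall>i. part m i \<le> part l i)"
proof
  assume sub: "diagram m \<subseteq> diagram l"
  show "\<forall>i. part m i \<le> part l i"
  proof
    fix i
    show "part m i \<le> part l i"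
      using subsetD[OF sub, of "(i, part m i)"] by (cases "part m i = 0") (auto simp: mem_diagram_iff)
  qed
next
  assume le: "\<forall>i. part m i \<le> part l i"
  show "diagram m \<subseteq> diagram l"
    using le by (force simp: mem_diagram_iff intro: order_trans)
qed

lemma mem_skew_iff: "(i, j) \<in> diagram l - diagram m \<longleftrightarrow> part m i < j \<and> j \<le> part l i"
  by (auto simp: mem_diagram_iff)

text \<open>Row-length form of a nonempty rim hook with outer shape \<open>a\<close> and inner shape
  \<open>b\<close>, occupying rows \<open>p\<close> to \<open>q\<close>. The equation
  \<open>Suc (b j) = a (Suc j)\<close> says that rows \<open>j\<close> and \<open>Suc j\<close>
  share exactly one column.\<close>

definition ribbon :: "(nat \<Rightarrow> nat) \<Rightarrow> (nat \<Rightarrow> nat) \<Rightarrow> nat \<Rightarrow> nat \<Rightarrow> bool" where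
  "ribbon a b p q \<longleftrightarrow> 1 \<le> p \<and> p \<le> q \<and> b q < a q \<and> (\<forall>j. j < p \<or> q < j \<longrightarrow> b j = a j) \<and>
     (\<forall>j. p \<le> j \<and> j < q \<longrightarrow> Suc (b j) = a (Suc j))"

text \<open>Consecutive rows of a connected skew shape overlap, and without a 2x2 block the overlap is a
  single column.\<close>

lemma rim_hook_imp_ribbon:
  assumes hook: "rim_hook l m" and "l \<noteq> m"
  shows "\<exists>p q. ribbon (part l) (part m) p q"
proof -
  have l: "is_partition l" and m: "is_partition m"
    and le: "\<And>i. part m i \<le> part l i"
    and conn: "connected_boxes (diagram l - diagram m)"
    and no2: "\<not> has_2x2_block (diagram l - diagram m)"
    using hook by (auto simp: rim_hook_def diagram_subset_iff)
  define R where "R = {i. part m i < part l i}"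
  have "R \<subseteq> {1..length l}"
    using part_pos_iff[OF l] by (fastforce simp: R_def)
  then have fin: "finite R" by (rule finite_subset) simp
  have "R \<noteq> {}"
    using partition_eqI[OF l m] le \<open>l \<noteq> m\<close> unfolding R_def
    by (metis (mono_tags, lifting) empty_Collect_eq le_neq_implies_less)
  define p where "p = Min R"
  define q where "q = Max R"
  have pR: "p \<in> R" and qR: "q \<in> R" and pq: "p \<le> q"
    using fin \<open>R \<noteq> {}\<close> by (auto simp: p_def q_def)
  have "1 \<le> p" using pR \<open>R \<subseteq> {1..length l}\<close> by auto
  have outside: "part m j = part l j" if "j < p \<or> q < j" for j
  proof -
    have "j \<notin> R"
      using that Min_le[OF fin, of j] Max_ge[OF fin, of j] unfolding p_def q_def by linarith
    then show ?thesis using le[of j] by (auto simp: R_def)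
  qed
  have step: "Suc (part m i) = part l (Suc i)" if i: "p \<le> i" "i < q" for i
  proof -
    let ?D = "diagram l - diagram m"
    let ?adj = "\<lambda>x y. x \<in> ?D \<and> y \<in> ?D \<and> adjacent_boxes x y"
    have "\<exists>j. (i, j) \<in> ?D \<and> (Suc i, j) \<in> ?D"
    proof (rule ccontr)
      assume no: "\<nexists>j. (i, j) \<in> ?D \<and> (Suc i, j) \<in> ?D"
      have "(p, part l p) \<in> ?D" "(q, part l q) \<in> ?D"
        using pR qR by (auto simp: mem_skew_iff R_def simp del: Diff_iff)
      then have "?adj\<^sup>*\<^sup>* (p, part l p) (q, part l q)"
        using conn by (auto simp: connected_boxes_def)
      \<comment> \<open>A path of boxes that starts in row \<open>p \<le> i\<close> can enter row
        \<open>Suc i\<close> only from row \<open>i\<close> within one column, and \<open>no\<close>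
        excludes such a column.\<close>
      then have "fst (q, part l q) \<le> i"
      proof (induction rule: rtranclp_induct)
        case base
        then show ?case using i by simp
      next
        case (step y z)
        obtain y1 y2 z1 z2 where [simp]: "y = (y1, y2)" "z = (z1, z2)"
          by (cases y, cases z) auto
        show ?case
        proof (rule ccontr)
          assume "\<not> fst z \<le> i"
          then have "y1 = i" "z1 = Suc i" "z2 = y2"
            using step by (auto simp: adjacent_boxes_def)
          then show False using step no by auto
        qed
      qed
      then show False using i by simp
    qed
    then have ge: "part m i < part l (Suc i)"
      by (auto simp: mem_skew_iff simp del: Diff_iff)
    have "part l (Suc i) \<le> Suc (part m i)"
    proof (rule ccontr)
      assume big: "\<not> part l (Suc i) \<le> Suc (part m i)"
      have "1 \<le> i" using i \<open>1 \<le> p\<close> by simp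
      then have "part l (Suc i) \<le> part l i" "part m (Suc i) \<le> part m i"
        by (auto intro!: part_antimono l m)
      \<comment> \<open>Otherwise rows \<open>i\<close> and \<open>Suc i\<close> share the first two
        columns to the right of \<open>part m i\<close>.\<close>
      then have "{(i, Suc (part m i)), (i, Suc (Suc (part m i))),
          (Suc i, Suc (part m i)), (Suc i, Suc (Suc (part m i)))} \<subseteq> ?D"
        using big by (simp add: mem_skew_iff del: Diff_iff)
      then show False using no2 unfolding has_2x2_block_def by blast
    qed
    then show ?thesis using ge by simp
  qed
  have "ribbon (part l) (part m) p q"
    using \<open>1 \<le> p\<close> pq qR outside step by (auto simp: ribbon_def R_def)
  then show ?thesis by blast
qed

text \<open>Above the last row, the one-column overlap gives
  \<open>Suc (b i) = part l (Suc i) \<le> part l i\<close>.\<close>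

lemma ribbon_less:
  assumes "is_partition l" "ribbon (part l) b p q" "p \<le> i" "i \<le> q"
  shows "b i < part l i"
proof (cases "i = q")
  case False
  then have "Suc (b i) = part l (Suc i)" using assms by (auto simp: ribbon_def)
  also have "\<dots> \<le> part l i" using assms by (intro part_antimono) (auto simp: ribbon_def)
  finally show ?thesis by simp
qed (use assms in \<open>auto simp: ribbon_def\<close>)

text \<open>Each box is joined along its row to the right end of that row, and the leftmost box of
  row \<open>n\<close> sits directly above the rightmost box of row \<open>Suc n\<close>. Hence
  every box is connected to the right end of row \<open>p\<close>.\<close>

lemma ribbon_imp_rim_hook:
  assumes l: "is_partition l" and m: "is_partition m" and rib: "ribbon (part l) (part m) p q"
  shows "rim_hook l m"
proof -
  note less = ribbon_less[OF l rib]
  have outside: "part m j = part l j" if "\<not> (p \<le> j \<and> j \<le> q)" for j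
    using rib that by (auto simp: ribbon_def)
  have step: "Suc (part m j) = part l (Suc j)" if "p \<le> j" "j < q" for j
    using rib that by (auto simp: ribbon_def)
  have sub: "diagram m \<subseteq> diagram l"
    unfolding diagram_subset_iff by (metis less outside le_refl less_imp_le)
  let ?D = "diagram l - diagram m"
  define adj where "adj = (\<lambda>x y. x \<in> ?D \<and> y \<in> ?D \<and> adjacent_boxes x y)"
  have rows: "p \<le> i \<and> i \<le> q" if "(i, j) \<in> ?D" for i j
    using that outside[of i] by (auto simp: mem_skew_iff simp del: Diff_iff)
  have row: "adj\<^sup>*\<^sup>* (i, part l i) (i, j)" if "(i, j) \<in> ?D" for i j
  proof -
    have "j \<le> part l i" "part m i < j" using that by (auto simp: mem_skew_iff simp del: Diff_iff)
    then show ?thesis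
    proof (induction rule: inc_induct)
      case (step n)
      have "adj (i, Suc n) (i, n)"
        using step by (auto simp: adj_def mem_skew_iff adjacent_boxes_def simp del: Diff_iff)
      moreover have "adj\<^sup>*\<^sup>* (i, part l i) (i, Suc n)"
        using step by simp
      ultimately show ?case by (rule rtranclp.rtrancl_into_rtrancl[rotated])
    qed simp
  qed
  have first: "adj\<^sup>*\<^sup>* (p, part l p) (i, part l i)" if "p \<le> i" "i \<le> q" for i
    using that
  proof (induction rule: dec_induct)
    case (step n)
    have "(n, Suc (part m n)) \<in> ?D" "(Suc n, part l (Suc n)) \<in> ?D"
      using step.hyps step.prems less[of n] less[of "Suc n"]
      by (auto simp: mem_skew_iff simp del: Diff_iff)
    moreover have "Suc (part m n) = part l (Suc n)"
      using \<open>\<And>j. p \<le> j \<Longrightarrow> j < q \<Longrightarrow> Suc (part m j) = part l (Suc j)\<close> step by simp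
    ultimately have "adj (n, Suc (part m n)) (Suc n, part l (Suc n))"
      by (auto simp: adj_def adjacent_boxes_def)
    moreover have "adj\<^sup>*\<^sup>* (n, part l n) (n, Suc (part m n))"
      by (rule row) fact
    moreover have "adj\<^sup>*\<^sup>* (p, part l p) (n, part l n)"
      using step by simp
    ultimately show ?case
      by (meson rtranclp.rtrancl_into_rtrancl rtranclp_trans)
  qed simp
  have "symp adj" by (rule sympI) (auto simp: adj_def adjacent_boxes_def)
  then have sym: "symp adj\<^sup>*\<^sup>*" by (rule symp_rtranclp)
  have reach: "adj\<^sup>*\<^sup>* (p, part l p) b" if "b \<in> ?D" for b
  proof -
    obtain i j where b: "b = (i, j)" by (cases b)
    show ?thesis
      using that rows[of i j] row[of i j] first[of i] unfolding b by (meson rtranclp_trans)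
  qed
  have "connected_boxes ?D"
    unfolding connected_boxes_def adj_def[symmetric] using reach sym by (meson rtranclp_trans sympD)
  moreover have "\<not> has_2x2_block ?D"
  proof
    assume "has_2x2_block ?D"
    \<comment> \<open>The diagonal of a block suffices: it gives \<open>part m i < j\<close>, but
      also \<open>Suc j \<le> part l (Suc i) = Suc (part m i)\<close>.\<close>
    then obtain i j where "(i, j) \<in> ?D" "(Suc i, Suc j) \<in> ?D"
      unfolding has_2x2_block_def by blast
    then show False
      using rows[of i j] rows[of "Suc i" "Suc j"] step[of i]
      by (auto simp: mem_skew_iff simp del: Diff_iff)
  qed
  ultimately show ?thesis using l m sub by (simp add: rim_hook_def)
qed

text \<open>Since \<open>part m j + 1 = part l (Suc j)\<close> inside the ribbon, the row sums
  telescope. Written additively to avoid truncated subtraction, this says that the size is the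
  distance from the bead of row \<open>p\<close> of \<open>l\<close> down to the bead of row
  \<open>q\<close> of \<open>m\<close>.\<close>

lemma card_ribbon:
  assumes l: "is_partition l" and rib: "ribbon (part l) (part m) p q"
  shows "card (diagram l - diagram m) + part m q + p = part l p + q"
proof -
  note less = ribbon_less[OF l rib]
  have outside: "part m j = part l j" if "\<not> (p \<le> j \<and> j \<le> q)" for j
    using rib that by (auto simp: ribbon_def)
  have step: "Suc (part m j) = part l (Suc j)" if "p \<le> j" "j < q" for j
    using rib that by (auto simp: ribbon_def)
  have pq: "p \<le> q" using rib by (simp add: ribbon_def)
  have "diagram l - diagram m = Sigma {p..q} (\<lambda>i. {part m i<..part l i})"
    (is "?L = ?R")
  proof (rule set_eqI)
    fix x :: "nat \<times> nat"
    obtain i j where "x = (i, j)" by (cases x)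
    then show "x \<in> ?L \<longleftrightarrow> x \<in> ?R"
      using outside[of i] by (cases "p \<le> i \<and> i \<le> q") (auto simp add: mem_skew_iff simp del: Diff_iff)
  qed
  then have "card (diagram l - diagram m) = (\<Sum>i=p..q. part l i - part m i)"
    by simp
  moreover have "(\<Sum>i=p..q. part l i - part m i) + (\<Sum>i=p..q. part m i) = (\<Sum>i=p..q. part l i)"
    unfolding sum.distrib[symmetric] using less by (intro sum.cong) (auto simp: less_imp_le)
  moreover have "(\<Sum>i=p..q. part m i) = (\<Sum>i=p..<q. part m i) + part m q"
    using pq by (simp add: sum.last_plus add.commute)
  moreover have "(\<Sum>i=p..<q. part m i) + (q - p) = (\<Sum>i=p..<q. part l (Suc i))"
  proof -
    have "(\<Sum>i=p..<q. part l (Suc i)) = (\<Sum>i=p..<q. part m i + 1)"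
      by (rule sum.cong) (simp_all add: step)
    then show ?thesis by (simp only: sum.distrib) simp
  qed
  moreover have "(\<Sum>i=p..<q. part l (Suc i)) + part l p = (\<Sum>i=p..q. part l i)"
    using pq by (metis sum.atLeast_Suc_lessThan_Suc_shift sum.head add.commute
        sum.atLeast_Suc_atMost atLeastLessThanSuc_atLeastAtMost sum.shift_bounds_Suc_ivl)
  ultimately show ?thesis using pq by linarith
qed

section \<open>Beads\<close>

text \<open>The beta-set of \<open>l\<close> with \<open>r\<close> elements: for at most
  \<open>r\<close> parts, these are the ones of the abacus at positions from \<open>-r\<close>
  upwards, shifted by \<open>r\<close>. Empty rows contribute beads too, so the number of beads does
  not depend on the number of parts.\<close>

definition beads :: "nat \<Rightarrow> nat list \<Rightarrow> nat set" where
  "beads r l = (\<lambda>j. part l j + (r - j)) ` {1..r}"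

lemma bead_less:
  assumes "is_partition l" "1 \<le> i" "i < j" "j \<le> r"
  shows "part l j + (r - j) < part l i + (r - i)"
  using part_antimono[of l i j] assms by linarith

lemma inj_on_bead: "is_partition l \<Longrightarrow> inj_on (\<lambda>j. part l j + (r - j)) {1..r}"
  by (rule linorder_inj_onI') (use bead_less in \<open>fastforce\<close>)

lemma finite_beads [simp]: "finite (beads r l)"
  by (simp add: beads_def)

lemma card_beads: "is_partition l \<Longrightarrow> card (beads r l) = r"
  unfolding beads_def by (subst card_image[OF inj_on_bead]) simp_all

text \<open>Beads strictly decrease with the row, so listing them in increasing order recovers the
  rows from \<open>r\<close> up to \<open>1\<close>; subtracting \<open>k\<close> from entry
  \<open>k\<close> gives the row length.\<close>

lemma beads_inj:
  assumes l: "is_partition l" "length l \<le> r" and m: "is_partition m" "length m \<le> r"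
    and eq: "beads r l = beads r m"
  shows "l = m"
proof (rule partition_eqI)
  define g where "g l = map (\<lambda>k. part l (r - k) + k) [0..<r]" for l
  have g: "sorted_list_of_set (beads r l) = g l" if "is_partition l" for l
  proof (rule strict_sorted_equal)
    show "sorted_wrt (<) (g l)"
      unfolding sorted_wrt_iff_nth_less
    proof (intro allI impI)
      fix i j assume ij: "i < j" "j < length (g l)"
      then have "part l (r - i) \<le> part l (r - j)"
        by (intro part_antimono that) (auto simp: g_def)
      then show "g l ! i < g l ! j" using ij by (simp add: g_def)
    qed
    have "beads r l = (\<lambda>k. part l (r - k) + k) ` {0..<r}"
      unfolding beads_def
    proof (intro equalityI subsetI)
      fix x assume "x \<in> (\<lambda>j. part l j + (r - j)) ` {1..r}"
      then obtain j where "j \<in> {1..r}" "x = part l j + (r - j)" by auto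
      then show "x \<in> (\<lambda>k. part l (r - k) + k) ` {0..<r}"
        by (intro image_eqI[of _ _ "r - j"]) auto
    next
      fix x assume "x \<in> (\<lambda>k. part l (r - k) + k) ` {0..<r}"
      then obtain j where "j \<in> {0..<r}" "x = part l (r - j) + j" by auto
      then show "x \<in> (\<lambda>j. part l j + (r - j)) ` {1..r}"
        by (intro image_eqI[of _ _ "r - j"]) auto
    qed
    then show "set (sorted_list_of_set (beads r l)) = set (g l)"
      by (simp add: g_def)
  qed simp
  have "g l = g m" using g[of l] g[of m] l m eq by simp
  then have *: "part l (r - k) = part m (r - k)" if "k < r" for k
    using that by (simp add: g_def)
  fix j
  show "part l j = part m j"
  proof (cases "j = 0 \<or> r < j")
    case True
    then show ?thesis using l m by (auto simp: part_beyond)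
  next
    case False
    then show ?thesis using *[of "r - j"] by simp
  qed
qed (use l m in auto)

text \<open>The row lengths are obtained by subtracting from each element of \<open>X\<close> the
  number of smaller elements of \<open>X\<close>.\<close>

lemma beads_surj:
  assumes "finite X" "card X = r"
  obtains l where "is_partition l" "length l \<le> r" "beads r l = X"
proof -
  define xs where "xs = sorted_list_of_set X"
  have len: "length xs = r" and set: "set xs = X" and sorted: "sorted_wrt (<) xs"
    using assms by (auto simp: xs_def)
  \<comment> \<open>Strictly increasing naturals gain at least one per index. This makes
    \<open>f\<close> weakly decreasing and, for \<open>i = 0\<close>, keeps the subtraction in
    \<open>f\<close> from truncating.\<close>
  have gap: "xs ! i + (j - i) \<le> xs ! j" if "i \<le> j" "j < r" for i j
    using that
  proof (induction rule: dec_induct)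
    case (step n)
    then have "xs ! n < xs ! Suc n"
      using sorted len by (auto simp: sorted_wrt_iff_nth_less)
    then show ?case using step by simp
  qed simp
  define f where "f j = (if 1 \<le> j \<and> j \<le> r then xs ! (r - j) - (r - j) else 0)" for j
  obtain l where l: "is_partition l" "length l \<le> r" "part l = f"
  proof (rule partition_of_parts[of f r])
    fix i j :: nat assume ij: "1 \<le> i" "i \<le> j"
    show "f j \<le> f i"
    proof (cases "j \<le> r")
      case True
      then have "xs ! (r - j) + (r - i - (r - j)) \<le> xs ! (r - i)"
        using ij by (intro gap) auto
      then show ?thesis using ij True unfolding f_def by auto
    qed (use ij in \<open>simp add: f_def\<close>)
  qed (auto simp: f_def)
  have "beads r l = (\<lambda>j. xs ! (r - j)) ` {1..r}"
    unfolding beads_def l(3)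
  proof (rule image_cong)
    fix j assume "j \<in> {1..r}"
    then show "f j + (r - j) = xs ! (r - j)"
      using gap[of 0 "r - j"] by (auto simp: f_def)
  qed simp
  also have "\<dots> = (\<lambda>k. xs ! k) ` {0..<r}"
  proof -
    have "(\<lambda>j. r - j) ` {1..r} = {0..<r}"
    proof (intro equalityI subsetI)
      fix k assume "k \<in> {0..<r}"
      then show "k \<in> (\<lambda>j. r - j) ` {1..r}" by (intro image_eqI[of _ _ "r - k"]) auto
    qed auto
    then show ?thesis by (metis image_image)
  qed
  also have "\<dots> = X"
    using set len by (metis list.set_map map_nth set_upt)
  finally show thesis using l that by blast
qed

text \<open>The largest bead is that of the first row, at \<open>part l 1 + (r - 1)\<close>.\<close>

lemma part_1_le_iff_beads:
  assumes "is_partition l" "1 \<le> r"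
  shows "part l 1 \<le> s \<longleftrightarrow> beads r l \<subseteq> {..<r + s}"
proof
  assume le: "part l 1 \<le> s"
  have "part l j + (r - j) < r + s" if "j \<in> {1..r}" for j
    using part_antimono[OF assms(1), of 1 j] that le by auto
  then show "beads r l \<subseteq> {..<r + s}" by (auto simp: beads_def)
next
  assume sub: "beads r l \<subseteq> {..<r + s}"
  have "part l 1 + (r - 1) \<in> beads r l" using assms by (auto simp: beads_def)
  then show "part l 1 \<le> s" using sub assms by auto
qed

lemma bij_betw_beads:
  assumes "1 \<le> r"
  shows "bij_betw (beads r) (partitions_in_box r s) {X. X \<subseteq> {..<r + s} \<and> card X = r}"
proof (rule bij_betw_imageI)
  show "inj_on (beads r) (partitions_in_box r s)"
    by (rule inj_onI) (auto simp: partitions_in_box_def intro: beads_inj)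
  show "beads r ` partitions_in_box r s = {X. X \<subseteq> {..<r + s} \<and> card X = r}"
  proof (intro equalityI subsetI)
    fix X assume "X \<in> {X. X \<subseteq> {..<r + s} \<and> card X = r}"
    then have X: "X \<subseteq> {..<r + s}" "card X = r" "finite X" by (auto intro: finite_subset)
    obtain l where "is_partition l" "length l \<le> r" "beads r l = X"
      using beads_surj X by blast
    then show "X \<in> beads r ` partitions_in_box r s"
      using X assms part_1_le_iff_beads[of l r s] by (auto simp: partitions_in_box_def)
  qed (use assms part_1_le_iff_beads card_beads in \<open>auto simp: partitions_in_box_def\<close>)
qed

section \<open>Rim hook removal as a bead move\<close>

text \<open>For \<open>p \<le> j < q\<close> the bead of row \<open>j\<close> of \<open>m\<close>
  equals the bead of row \<open>j + 1\<close> of \<open>l\<close>. So only the bead of row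
  \<open>p\<close> of \<open>l\<close> disappears, and only that of row \<open>q\<close> of
  \<open>m\<close> is new; \<open>card_ribbon\<close> gives their distance \<open>t\<close>.\<close>

lemma ribbon_beads:
  assumes l: "is_partition l" "length l \<le> r" and m: "is_partition m"
    and rib: "ribbon (part l) (part m) p q"
    and t: "card (diagram l - diagram m) = t" and "1 \<le> t"
  shows "\<exists>x\<in>beads r l. t \<le> x \<and> x - t \<notin> beads r l \<and> beads r m = insert (x - t) (beads r l - {x})"
proof -
  define \<beta> where "\<beta> l j = part l j + (r - j)" for l j
  have q: "q \<le> r"
    using rib l part_pos_iff[of l q] by (auto simp: ribbon_def)
  have p: "1 \<le> p" "p \<le> q" using rib by (auto simp: ribbon_def)
  have outside: "\<beta> m j = \<beta> l j" if "\<not> (p \<le> j \<and> j \<le> q)" for j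
    using rib that by (auto simp: ribbon_def \<beta>_def)
  have step: "\<beta> m j = \<beta> l (Suc j)" if "p \<le> j" "j < q" for j
  proof -
    have "Suc (part m j) = part l (Suc j)" using rib that by (auto simp: ribbon_def)
    then show ?thesis using that q by (auto simp: \<beta>_def)
  qed
  have diff: "\<beta> m q + t = \<beta> l p"
    using card_ribbon[OF l(1) rib] t p q by (simp add: \<beta>_def)
  have inj: "inj_on (\<beta> l) {1..r}"
    using inj_on_bead[OF l(1)] by (simp add: \<beta>_def[abs_def])
  have B: "beads r l = \<beta> l ` {1..r}" "beads r m = \<beta> m ` {1..r}"
    by (auto simp: beads_def \<beta>_def)
  have parts: "{1..r} = {1..<p} \<union> {p..<q} \<union> {q} \<union> {q<..r}"
    using p q by auto
  have parts': "{1..r} - {p} = {1..<p} \<union> Suc ` {p..<q} \<union> {q<..r}"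
    using p q by (auto simp: image_Suc_atLeastLessThan)
  have "\<beta> m ` {1..<p} = \<beta> l ` {1..<p}" "\<beta> m ` {q<..r} = \<beta> l ` {q<..r}"
    by (auto simp: outside intro!: image_cong)
  moreover have "\<beta> m ` {p..<q} = \<beta> l ` Suc ` {p..<q}"
    unfolding image_image by (auto simp: step intro!: image_cong)
  ultimately have "beads r m = insert (\<beta> m q) (\<beta> l ` ({1..r} - {p}))"
    unfolding B parts' by (subst parts) (simp only: image_Un, auto)
  also have "\<beta> l ` ({1..r} - {p}) = beads r l - {\<beta> l p}"
    unfolding B using inj p q by (subst inj_on_image_set_diff[OF inj]) auto
  finally have new: "beads r m = insert (\<beta> l p - t) (beads r l - {\<beta> l p})"
    using diff by (metis add_diff_cancel_right')
  have mem: "\<beta> l p \<in> beads r l" using p q by (auto simp: B)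
  \<comment> \<open>If the target were occupied, \<open>m\<close> would have fewer than
    \<open>r\<close> beads.\<close>
  have "\<beta> l p - t \<notin> beads r l"
  proof
    assume "\<beta> l p - t \<in> beads r l"
    then have "beads r m = beads r l - {\<beta> l p}"
      using new diff \<open>1 \<le> t\<close> by auto
    then show False
      using card_beads[OF l(1), of r] card_beads[OF m, of r] mem p q
      by (metis card_Diff1_less finite_beads less_irrefl)
  qed
  then show ?thesis using mem new diff by (intro bexI[of _ "\<beta> l p"]) auto
qed

lemma remove_rim_hook_beads:
  assumes l: "is_partition l" "length l \<le> r" and "1 \<le> t" and rem: "remove_rim_hook t l m"
  shows "\<exists>x\<in>beads r l. t \<le> x \<and> x - t \<notin> beads r l \<and> beads r m = insert (x - t) (beads r l - {x})"
proof -
  have "l \<noteq> m" using rem \<open>1 \<le> t\<close> by (auto simp: remove_rim_hook_def)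
  then obtain p q where "ribbon (part l) (part m) p q"
    using rim_hook_imp_ribbon[of l m] rem by (auto simp: remove_rim_hook_def)
  then show ?thesis
    using rem assms by (intro ribbon_beads) (auto simp: remove_rim_hook_def rim_hook_def)
qed

lemma remove_rim_hook_partition:
  assumes "remove_rim_hook t l m"
  shows "is_partition m" "length m \<le> length l"
proof -
  show m: "is_partition m" using assms by (simp add: remove_rim_hook_def rim_hook_def)
  have "part m (length m) \<le> part l (length m)"
    using assms by (simp add: remove_rim_hook_def rim_hook_def diagram_subset_iff)
  then show "length m \<le> length l"
    using part_pos_iff[OF m, of "length m"] part_beyond[of l "length m"] by linarith
qed

text \<open>Moving the bead of row \<open>p\<close> from \<open>x\<close> down to
  \<open>x - t\<close> makes it jump over the beads of rows \<open>p + 1\<close> to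
  \<open>q\<close>. Each of these moves up one row, which shortens its row length by one, and this
  is the ribbon condition.\<close>

lemma ex_remove_rim_hook:
  assumes l: "is_partition l" "length l \<le> r" and "1 \<le> t"
    and x: "x \<in> beads r l" "t \<le> x" "x - t \<notin> beads r l"
  shows "\<exists>m. remove_rim_hook t l m"
proof -
  define \<beta> where "\<beta> j = part l j + (r - j)" for j
  obtain p where p: "1 \<le> p" "p \<le> r" "x = \<beta> p"
    using x(1) by (auto simp: beads_def \<beta>_def)
  have less: "\<beta> j < \<beta> i" if "1 \<le> i" "i < j" "j \<le> r" for i j
    using bead_less[OF l(1) that] by (simp add: \<beta>_def)
  \<comment> \<open>The last row whose bead lies above \<open>x - t\<close> becomes the row of the
    moved bead.\<close>
  define Q where "Q = {j \<in> {1..r}. x - t < \<beta> j}"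
  define q where "q = Max Q"
  have "finite Q" "p \<in> Q" using p x(2) \<open>1 \<le> t\<close> by (auto simp: Q_def)
  then have "q \<in> Q" and "p \<le> q" and qmax: "\<And>j. j \<in> Q \<Longrightarrow> j \<le> q"
    unfolding q_def by (auto intro: Max_in)
  then have q: "1 \<le> q" "q \<le> r" "x - t < \<beta> q" by (auto simp: Q_def)
  \<comment> \<open>The next bead is strictly below the vacant position \<open>x - t\<close>; using
    \<open>r - q\<close> in place of \<open>r - Suc q\<close> expresses this strictness. It also
    shows \<open>r - q \<le> x - t\<close>, so the length of the new row \<open>q\<close> does not
    truncate.\<close>
  have below: "part l (Suc q) + (r - q) \<le> x - t"
  proof (cases "q < r")
    case True
    then have "\<not> x - t < \<beta> (Suc q)" using qmax[of "Suc q"] by (auto simp: Q_def)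
    moreover have "\<beta> (Suc q) \<in> beads r l" using True by (auto simp: beads_def \<beta>_def)
    ultimately have "\<beta> (Suc q) < x - t" using x(3) by (metis linorder_neqE_nat)
    then show ?thesis using True by (simp add: \<beta>_def)
  next
    case False
    then show ?thesis using l by (simp add: part_beyond)
  qed
  define b where "b j = (if p \<le> j \<and> j < q then part l (Suc j) - 1
     else if j = q then x - t - (r - q) else part l j)" for j
  have anti: "part l j \<le> part l i" if "1 \<le> i" "i \<le> j" for i j
    using part_antimono[OF l(1) that] .
  have bq: "b q < part l q" using q \<open>p \<le> q\<close> below by (auto simp: b_def \<beta>_def)
  have pos: "0 < part l j" if "1 \<le> j" "j \<le> q" for j
    using anti[OF that] bq by simp
  have b_le: "b j \<le> part l j" if "1 \<le> j" for j
    using bq anti[of j "Suc j"] that by (auto simp: b_def)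
  have b_ge: "part l (Suc j) - 1 \<le> b j" "j = q \<or> \<not> (p \<le> j \<and> j \<le> q) \<Longrightarrow> part l (Suc j) \<le> b j"
    if "1 \<le> j" for j
    using below anti[of j "Suc j"] that by (auto simp: b_def)
  \<comment> \<open>The value \<open>part l (Suc j)\<close>, lowered by one when
    \<open>p \<le> j < q\<close>, separates \<open>b (Suc j)\<close> from
    \<open>b j\<close>.\<close>
  have b_anti1: "b (Suc j) \<le> b j" if "1 \<le> j" for j
  proof (cases "p \<le> j \<and> j < q")
    case True
    have "b (Suc j) \<le> part l (Suc j) - 1"
    proof (cases "Suc j = q")
      case False
      then have "b (Suc j) = part l (Suc (Suc j)) - 1" using True by (simp add: b_def)
      then show ?thesis using anti[of "Suc j" "Suc (Suc j)"] by simp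
    qed (use bq in simp)
    then show ?thesis using True by (simp add: b_def)
  next
    case False
    then show ?thesis
      using b_le[of "Suc j"] b_ge(2)[OF that] by linarith
  qed
  obtain m where m: "is_partition m" "length m \<le> r" "part m = b"
  proof (rule partition_of_parts[of b r])
    fix i j :: nat assume "1 \<le> i" "i \<le> j"
    from this(2,1) show "b j \<le> b i"
      by (induction rule: dec_induct) (auto intro: order_trans[OF b_anti1])
  qed (use l q p \<open>p \<le> q\<close> in \<open>auto simp: b_def part_beyond\<close>)
  have rib: "ribbon (part l) (part m) p q"
    unfolding ribbon_def m(3) using p \<open>p \<le> q\<close> bq pos by (auto simp: b_def)
  have "card (diagram l - diagram m) + b q + p = part l p + q"
    using card_ribbon[OF l(1) rib] m by simp
  moreover have "b q + (r - q) = x - t" using below by (simp add: b_def)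
  ultimately have "card (diagram l - diagram m) = t"
    using p q \<open>p \<le> q\<close> x(2) by (simp add: \<beta>_def)
  then have "remove_rim_hook t l m"
    using ribbon_imp_rim_hook[OF l(1) m(1) rib] by (simp add: remove_rim_hook_def)
  then show ?thesis by blast
qed

section \<open>Cores on the abacus\<close>

text \<open>The abacus form of being a \<open>t\<close>-core: no bead can slide down its
  runner.\<close>

definition flush :: "nat \<Rightarrow> nat set \<Rightarrow> bool" where
  "flush t X \<longleftrightarrow> (\<forall>x\<in>X. t \<le> x \<longrightarrow> x - t \<in> X)"

definition runner :: "nat \<Rightarrow> nat set \<Rightarrow> nat \<Rightarrow> nat set" where
  "runner t X i = {x \<in> X. x mod t = i}"

lemma finite_runner [simp]: "finite X \<Longrightarrow> finite (runner t X i)"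
  by (simp add: runner_def)

lemma Union_runner: "0 < t \<Longrightarrow> (\<Union>i<t. runner t X i) = X"
  by (auto simp: runner_def)

lemma card_eq_sum_runner:
  assumes "finite X" "0 < t"
  shows "card X = (\<Sum>i<t. card (runner t X i))"
proof -
  have "card (\<Union>i<t. runner t X i) = (\<Sum>i<t. card (runner t X i))"
    using assms by (intro card_UN_disjoint) (auto simp: runner_def)
  then show ?thesis using assms by (simp add: Union_runner)
qed

lemma down_closed_eq_lessThan:
  fixes K :: "nat set"
  assumes "finite K" and "\<And>k. Suc k \<in> K \<Longrightarrow> k \<in> K"
  shows "K = {..<card K}"
proof (cases "K = {}")
  case False
  have "j \<in> K" if "j \<le> k" "k \<in> K" for j k
    using that by (induction rule: inc_induct) (auto intro: assms(2))
  then have "K = {..Max K}"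
    using assms(1) False by (auto intro: Max_ge Max_in)
  then show ?thesis by (metis card_atMost lessThan_Suc_atMost)
qed simp

text \<open>With the positions of the runner numbered by \<open>k = x div t\<close>, flushness makes
  the occupied \<open>k\<close> closed under predecessors, hence an initial segment.\<close>

lemma flush_runner:
  assumes "flush t X" "finite X" "0 < t" "i < t"
  shows "runner t X i = (\<lambda>k. i + t * k) ` {..<card (runner t X i)}"
proof -
  define K where "K = {k. i + t * k \<in> X}"
  have inj: "inj_on (\<lambda>k. i + t * k) A" for A
    using assms(3) by (auto intro: inj_onI)
  have eq: "runner t X i = (\<lambda>k. i + t * k) ` K"
  proof (intro equalityI subsetI)
    fix x assume "x \<in> runner t X i"
    then have "x \<in> X" "i + t * (x div t) = x" by (auto simp: runner_def)
    then show "x \<in> (\<lambda>k. i + t * k) ` K" unfolding K_def by (intro image_eqI[of _ _ "x div t"]) auto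
  qed (use assms in \<open>auto simp: runner_def K_def\<close>)
  have "finite K"
    by (rule finite_imageD[OF _ inj]) (simp flip: eq add: assms(2))
  moreover have "k \<in> K" if "Suc k \<in> K" for k
  proof -
    have "i + t * Suc k \<in> X" using that by (simp add: K_def)
    moreover have "t \<le> i + t * Suc k" by simp
    ultimately have "i + t * Suc k - t \<in> X" using assms(1) unfolding flush_def by blast
    then show ?thesis by (simp add: K_def)
  qed
  ultimately have "K = {..<card K}" by (rule down_closed_eq_lessThan)
  moreover have "card (runner t X i) = card K"
    unfolding eq by (rule card_image[OF inj])
  ultimately show ?thesis using eq by metis
qed

text \<open>Each runner of a flush set is determined by its size, and the runners make up the whole
  set. This is the source of the uniqueness of the core.\<close>

lemma flush_unique:
  assumes "flush t X" "flush t Y" "finite X" "finite Y" "0 < t"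
    and "\<And>i. i < t \<Longrightarrow> card (runner t X i) = card (runner t Y i)"
  shows "X = Y"
proof -
  have "runner t X i = runner t Y i" if "i < t" for i
    using flush_runner[of t X i] flush_runner[of t Y i] assms that by metis
  then have "(\<Union>i<t. runner t X i) = (\<Union>i<t. runner t Y i)" by simp
  then show ?thesis by (simp only: Union_runner[OF \<open>0 < t\<close>])
qed

text \<open>As \<open>x\<close> and \<open>x - t\<close> are congruent modulo \<open>t\<close>, one
  runner exchanges an element and the others are unchanged.\<close>

lemma card_runner_move:
  assumes "finite X" "x \<in> X" "t \<le> x" "x - t \<notin> X"
  shows "card (runner t (insert (x - t) (X - {x})) i) = card (runner t X i)"
proof (cases "x mod t = i")
  case True
  have "(x - t) mod t = i" using True assms(3) le_mod_geq by metis
  then have "runner t (insert (x - t) (X - {x})) i = insert (x - t) (runner t X i - {x})"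
    by (auto simp: runner_def)
  moreover have "x - t \<notin> runner t X i - {x}" "x \<in> runner t X i"
    using assms True by (auto simp: runner_def)
  ultimately show ?thesis
    using assms(1) by (metis card_Suc_Diff1 card_insert_disjoint finite_Diff finite_runner)
next
  case False
  have "(x - t) mod t \<noteq> i" using False assms(3) le_mod_geq by metis
  then have "runner t (insert (x - t) (X - {x})) i = runner t X i"
    using False by (auto simp: runner_def)
  then show ?thesis by simp
qed

lemma no_rim_hook_iff_flush:
  assumes "is_partition l" "length l \<le> r" "1 \<le> t"
  shows "(\<nexists>m. remove_rim_hook t l m) \<longleftrightarrow> flush t (beads r l)"
proof
  assume "\<nexists>m. remove_rim_hook t l m"
  then show "flush t (beads r l)"
    using ex_remove_rim_hook[OF assms] unfolding flush_def by blast
next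
  assume "flush t (beads r l)"
  then show "\<nexists>m. remove_rim_hook t l m"
    using remove_rim_hook_beads[OF assms] unfolding flush_def by blast
qed

section \<open>Existence, uniqueness and size of the core\<close>

lemma remove_rim_hooks_invariant:
  assumes "(remove_rim_hook t)\<^sup>*\<^sup>* l m" and l: "is_partition l" "length l \<le> r" and "1 \<le> t"
  shows "is_partition m \<and> length m \<le> r \<and>
    (\<forall>i. card (runner t (beads r m) i) = card (runner t (beads r l) i))"
  using assms(1)
proof (induction rule: rtranclp_induct)
  case base
  then show ?case using l by simp
next
  case (step m k)
  then have m: "is_partition m" "length m \<le> r" by auto
  obtain x where "x \<in> beads r m" "t \<le> x" "x - t \<notin> beads r m"
    "beads r k = insert (x - t) (beads r m - {x})"
    using remove_rim_hook_beads[OF m \<open>1 \<le> t\<close> step.hyps(2)] by blast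
  then have "card (runner t (beads r k) i) = card (runner t (beads r m) i)" for i
    using card_runner_move[of "beads r m" x t i] by simp
  then show ?case
    using step.IH remove_rim_hook_partition[OF step.hyps(2)] by simp
qed

text \<open>Each removal takes away \<open>t \<ge> 1\<close> boxes, so the process stops.\<close>

lemma ex_terminal:
  assumes "1 \<le> t"
  shows "\<exists>m. (remove_rim_hook t)\<^sup>*\<^sup>* l m \<and> (\<nexists>k. remove_rim_hook t m k)"
proof (induction "card (diagram l)" arbitrary: l rule: less_induct)
  case less
  show ?case
  proof (cases "\<exists>k. remove_rim_hook t l k")
    case True
    then obtain k where k: "remove_rim_hook t l k" by blast
    then have "diagram k \<subseteq> diagram l" "diagram l - diagram k \<noteq> {}"
      using assms by (auto simp: remove_rim_hook_def rim_hook_def)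
    then have "card (diagram k) < card (diagram l)"
      by (intro psubset_card_mono) auto
    from less[OF this] show ?thesis using k by (meson converse_rtranclp_into_rtranclp)
  qed auto
qed

text \<open>Two end results of removals from \<open>l\<close> are both flush and have the runner
  sizes of \<open>l\<close>, so they have the same beads and coincide. Thus the \<open>THE\<close>
  in \<open>core\<close> denotes a genuine end result, without an analysis of how removals
  commute.\<close>

lemma core_properties:
  assumes l: "is_partition l" "length l \<le> r" and t: "1 \<le> t"
  shows "is_partition (core t l)" "length (core t l) \<le> r" "flush t (beads r (core t l))"
    "card (runner t (beads r (core t l)) i) = card (runner t (beads r l) i)"
proof -
  let ?P = "\<lambda>m. (remove_rim_hook t)\<^sup>*\<^sup>* l m \<and> (\<nexists>k. remove_rim_hook t m k)"
  have P: "is_partition m \<and> length m \<le> r \<and> flush t (beads r m) \<and>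
      (\<forall>i. card (runner t (beads r m) i) = card (runner t (beads r l) i))" if "?P m" for m
    using remove_rim_hooks_invariant[OF conjunct1[OF that] l t]
      no_rim_hook_iff_flush[of m r t] that t by simp
  have "m = m'" if "?P m" "?P m'" for m m'
  proof -
    note P[OF that(1)] P[OF that(2)]
    moreover from this have "beads r m = beads r m'"
      using t by (intro flush_unique[of t]) auto
    ultimately show ?thesis by (auto intro: beads_inj)
  qed
  then have "\<exists>!m. ?P m" using ex_terminal[OF t, of l] by blast
  then have "?P (core t l)" unfolding core_def by (rule theI')
  from P[OF this] show "is_partition (core t l)" "length (core t l) \<le> r"
    "flush t (beads r (core t l))"
    "card (runner t (beads r (core t l)) i) = card (runner t (beads r l) i)"
    by blast+
qed

lemma core_eq_iff:
  assumes l: "is_partition l" "length l \<le> r" and m: "is_partition m" "length m \<le> r"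
    and t: "1 \<le> t" and "flush t (beads r m)"
  shows "core t l = m \<longleftrightarrow> (\<forall>i<t. card (runner t (beads r l) i) = card (runner t (beads r m) i))"
proof
  assume "core t l = m"
  then show "\<forall>i<t. card (runner t (beads r l) i) = card (runner t (beads r m) i)"
    using core_properties(4)[OF l t] by simp
next
  assume eq: "\<forall>i<t. card (runner t (beads r l) i) = card (runner t (beads r m) i)"
  have "beads r (core t l) = beads r m"
    using core_properties[OF l t] eq assms by (intro flush_unique[of t]) auto
  then show "core t l = m"
    using core_properties[OF l t] m by (intro beads_inj) auto
qed

lemma core_self_iff:
  assumes "is_partition l" "length l \<le> r" "1 \<le> t"
  shows "core t l = l \<longleftrightarrow> flush t (beads r l)"
  using core_properties(3)[OF assms] core_eq_iff[OF assms(1,2,1,2,3)] by auto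

text \<open>A runner of the core holds at most \<open>r\<close> beads, all pushed down, so every
  bead is below \<open>t * r\<close>. The bound does not involve \<open>s\<close>, so one finite set
  of cores serves all box widths.\<close>

lemma core_in_box:
  assumes l: "is_partition l" "length l \<le> r" and t: "1 \<le> t" and r: "1 \<le> r"
  shows "core t l \<in> cores_in_box t r (r * t)"
proof -
  let ?c = "core t l"
  note c = core_properties[OF l t]
  have "x < r + r * t" if x: "x \<in> beads r ?c" for x
  proof -
    define i where "i = x mod t"
    have i: "i < t" using t by (simp add: i_def)
    have "x \<in> runner t (beads r ?c) i" using x by (simp add: runner_def i_def)
    then obtain k where k: "x = i + t * k" "k < card (runner t (beads r ?c) i)"
      using flush_runner[OF c(3) _ _ i] t by auto
    have "card (runner t (beads r ?c) i) \<le> card (beads r ?c)"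
      by (rule card_mono) (auto simp: runner_def)
    then have "card (runner t (beads r ?c) i) \<le> r" by (simp add: card_beads[OF c(1)])
    then have "t * Suc k \<le> t * r" using k by (intro mult_le_mono2) simp
    then show ?thesis using k i by (simp add: mult.commute)
  qed
  then have "part ?c 1 \<le> r * t" using part_1_le_iff_beads[OF c(1) r] by auto
  moreover have "core t ?c = ?c" using core_self_iff[OF c(1,2) t] c(3) by simp
  ultimately show ?thesis using c by (simp add: cores_in_box_def partitions_in_box_def)
qed

text \<open>Abacus position \<open>m\<close> corresponds to bead position \<open>m + r\<close>, so
  entry \<open>k\<close> of word \<open>i\<close> records whether \<open>i + t * k\<close> is a
  bead.\<close>

lemma ones_abacus_word:
  assumes l: "l \<in> partitions_in_box r s" and "1 \<le> r" and i: "i < t"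
  shows "ones (abacus_word t r s l i) = card (runner t (beads r l) i)"
proof -
  have len: "length l \<le> r" and part: "is_partition l" and bound: "beads r l \<subseteq> {..<r + s}"
    using l part_1_le_iff_beads[of l r s] assms by (auto simp: partitions_in_box_def)
  have ab: "abacus l (int x - int r) = (if x \<in> beads r l then 1 else 0)" for x
  proof -
    have "(\<exists>j\<ge>1. int x - int r = int (part l j) - int j) \<longleftrightarrow> x \<in> beads r l"
    proof
      assume "\<exists>j\<ge>1. int x - int r = int (part l j) - int j"
      then obtain j where j: "1 \<le> j" "int x - int r = int (part l j) - int j" by blast
      \<comment> \<open>A row beyond \<open>r\<close> is empty and would give the abacus position
        \<open>-j < -r\<close>.\<close>
      moreover have "j \<le> r" using j part_beyond[of l j] len by (cases "j \<le> r") auto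
      ultimately show "x \<in> beads r l" unfolding beads_def by (intro image_eqI[of _ _ j]) auto
    next
      assume "x \<in> beads r l"
      then obtain j where "1 \<le> j" "j \<le> r" "x = part l j + (r - j)" by (auto simp: beads_def)
      then show "\<exists>j\<ge>1. int x - int r = int (part l j) - int j" by (intro exI[of _ j]) auto
    qed
    then show ?thesis by (simp add: abacus_def)
  qed
  \<comment> \<open>The rounding up in \<open>word_length\<close> lists exactly the positions of the
    runner below \<open>r + s\<close>.\<close>
  have lt: "k < word_length t r s i \<longleftrightarrow> i + t * k < r + s" for k
  proof -
    have "k < word_length t r s i \<longleftrightarrow> Suc k * t \<le> r + s + t - 1 - i"
      unfolding word_length_def Suc_le_eq[symmetric] using i by (intro less_eq_div_iff_mult_less_eq) simp
    then show ?thesis using i by (auto simp: mult.commute)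
  qed
  have "ones (abacus_word t r s l i) =
      card {k. k < word_length t r s i \<and> abacus l (int (i + t * k) - int r) = 1}"
  proof -
    have "int (i + t * k) - int r = - int r + int i + int t * int k" for k by simp
    then show ?thesis
      by (auto simp: ones_def abacus_word_def count_list_eq_length_filter length_filter_conv_card algebra_simps
          intro!: arg_cong[of _ _ card])
  qed
  also have "{k. k < word_length t r s i \<and> abacus l (int (i + t * k) - int r) = 1} =
      {k. i + t * k \<in> beads r l}"
    unfolding ab lt using bound by auto
  also have "card \<dots> = card ((\<lambda>k. i + t * k) ` {k. i + t * k \<in> beads r l})"
    using i by (intro card_image[symmetric] inj_onI) auto
  also have "(\<lambda>k. i + t * k) ` {k. i + t * k \<in> beads r l} = runner t (beads r l) i"
  proof (intro equalityI subsetI)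
    fix x assume "x \<in> runner t (beads r l) i"
    then have "x \<in> beads r l" "i + t * (x div t) = x" by (auto simp: runner_def)
    then show "x \<in> (\<lambda>k. i + t * k) ` {k. i + t * k \<in> beads r l}"
      by (intro image_eqI[of _ _ "x div t"]) auto
  qed (use i in \<open>auto simp: runner_def\<close>)
  finally show ?thesis .
qed

section \<open>Counting the partitions with a given core\<close>

text \<open>A subset of \<open>{..<N}\<close> amounts to an independent choice of a subset on each
  runner; the inverse takes the union of the choices.\<close>

lemma card_prescribed_runners:
  assumes "0 < t"
  shows "card {X. X \<subseteq> {..<N} \<and> (\<forall>i<t. card (runner t X i) = a i)} =
    (\<Prod>i<t. card (runner t {..<N} i) choose a i)"
proof -
  let ?S = "{X. X \<subseteq> {..<N} \<and> (\<forall>i<t. card (runner t X i) = a i)}"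
  let ?T = "Pi\<^sub>E {..<t} (\<lambda>i. {Y. Y \<subseteq> runner t {..<N} i \<and> card Y = a i})"
  have run: "runner t (\<Union>i<t. f i) i = f i" if f: "f \<in> ?T" and i: "i < t" for f i
  proof -
    have "f j \<subseteq> runner t {..<N} j" if "j < t" for j using f that by (auto simp: PiE_iff)
    then show ?thesis using i by (fastforce simp: runner_def)
  qed
  have "bij_betw (\<lambda>X. restrict (runner t X) {..<t}) ?S ?T"
  proof (rule bij_betw_byWitness[where f' = "\<lambda>f. \<Union>i<t. f i"])
    show "\<forall>X\<in>?S. (\<Union>i<t. restrict (runner t X) {..<t} i) = X"
      using Union_runner[OF assms] by simp
    show "\<forall>f\<in>?T. restrict (runner t (\<Union>i<t. f i)) {..<t} = f"
    proof
      fix f assume f: "f \<in> ?T"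
      show "restrict (runner t (\<Union>i<t. f i)) {..<t} = f"
      proof (rule ext)
        fix i
        show "restrict (runner t (\<Union>i<t. f i)) {..<t} i = f i"
          using run[OF f, of i] f by (cases "i < t") (auto simp: PiE_iff extensional_def)
      qed
    qed
    show "(\<lambda>X. restrict (runner t X) {..<t}) ` ?S \<subseteq> ?T"
      by (auto simp: runner_def)
    show "(\<lambda>f. \<Union>i<t. f i) ` ?T \<subseteq> ?S"
    proof (rule image_subsetI)
      fix f assume f: "f \<in> ?T"
      have "f i \<subseteq> {..<N}" "card (f i) = a i" if "i < t" for i
        using f that by (auto simp: PiE_iff runner_def)
      then show "(\<Union>i<t. f i) \<in> ?S" using run[OF f] by auto
    qed
  qed
  then have "card ?S = card ?T" by (rule bij_betw_same_card)
  also have "\<dots> = (\<Prod>i<t. card (runner t {..<N} i) choose a i)"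
    by (simp add: card_PiE n_subsets)
  finally show ?thesis .
qed

lemma card_core_fibre:
  assumes \<rho>: "\<rho> \<in> cores_in_box t r (r * t)" and "1 \<le> r" and t: "1 \<le> t"
  shows "card {l \<in> partitions_in_box r s. core t l = \<rho>} =
    (\<Prod>i<t. card (runner t {..<r + s} i) choose card (runner t (beads r \<rho>) i))"
proof -
  have part: "is_partition \<rho>" "length \<rho> \<le> r" and core: "core t \<rho> = \<rho>"
    using \<rho> by (auto simp: cores_in_box_def partitions_in_box_def)
  have fl: "flush t (beads r \<rho>)" using core_self_iff[OF part t] core by simp
  let ?A = "{l \<in> partitions_in_box r s. core t l = \<rho>}"
  let ?B = "{X. X \<subseteq> {..<r + s} \<and> (\<forall>i<t. card (runner t X i) = card (runner t (beads r \<rho>) i))}"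
  \<comment> \<open>The prescribed runner sizes add up to \<open>r\<close>, so the condition on the
    cardinality in the bead bijection holds automatically on \<open>?B\<close>.\<close>
  have "card X = r" if X: "X \<in> ?B" for X
  proof -
    have "finite X" using X by (auto intro: finite_subset)
    then have "card X = card (beads r \<rho>)"
      using X t card_eq_sum_runner[of X t] card_eq_sum_runner[of "beads r \<rho>" t] by simp
    then show ?thesis by (simp add: card_beads[OF part(1)])
  qed
  then have B: "?B = {X \<in> {X. X \<subseteq> {..<r + s} \<and> card X = r}.
      \<forall>i<t. card (runner t X i) = card (runner t (beads r \<rho>) i)}"
    by blast
  have "core t l = \<rho> \<longleftrightarrow> (\<forall>i<t. card (runner t (beads r l) i) = card (runner t (beads r \<rho>) i))"
    if "l \<in> partitions_in_box r s" for l
    using that by (intro core_eq_iff part t fl) (auto simp: partitions_in_box_def)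
  then have A: "?A = {l \<in> partitions_in_box r s.
      \<forall>i<t. card (runner t (beads r l) i) = card (runner t (beads r \<rho>) i)}"
    by blast
  have "bij_betw (beads r) ?A ?B"
    unfolding A B by (rule bij_betw_Collect[OF bij_betw_beads[OF \<open>1 \<le> r\<close>]]) simp
  then have "card ?A = card ?B" by (rule bij_betw_same_card)
  then show ?thesis using card_prescribed_runners[of t "r + s"] t by simp
qed

section \<open>Asymptotics\<close>

text \<open>Position \<open>i + t * k\<close> is below \<open>N\<close> for every
  \<open>k < N div t\<close> and for no \<open>k > N div t\<close>.\<close>

lemma card_runner_lessThan:
  assumes "i < t"
  shows "N div t \<le> card (runner t {..<N} i)" "card (runner t {..<N} i) \<le> Suc (N div t)"
proof -
  let ?K = "{k. i + t * k < N}"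
  have "runner t {..<N} i = (\<lambda>k. i + t * k) ` ?K"
  proof (intro equalityI subsetI)
    fix x assume "x \<in> runner t {..<N} i"
    then have "x < N" "i + t * (x div t) = x" by (auto simp: runner_def)
    then show "x \<in> (\<lambda>k. i + t * k) ` ?K" by (intro image_eqI[of _ _ "x div t"]) auto
  qed (use assms in \<open>auto simp: runner_def\<close>)
  moreover have "inj_on (\<lambda>k. i + t * k) ?K" using assms by (auto intro: inj_onI)
  ultimately have card: "card (runner t {..<N} i) = card ?K" by (simp add: card_image)
  have sub: "?K \<subseteq> {..N div t}"
  proof
    fix k assume "k \<in> ?K"
    then have "k * t \<le> N" by (simp add: mult.commute)
    then show "k \<in> {..N div t}" using assms less_eq_div_iff_mult_less_eq[of t k N] by simp
  qed
  have "{..<N div t} \<subseteq> ?K"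
  proof
    fix k assume "k \<in> {..<N div t}"
    then have "Suc k * t \<le> N"
      using assms less_eq_div_iff_mult_less_eq[of t "Suc k" N] by auto
    then show "k \<in> ?K" using assms by (simp add: mult.commute)
  qed
  moreover have "finite ?K" using sub by (rule finite_subset) simp
  ultimately have "card {..<N div t} \<le> card ?K" by (intro card_mono)
  then show "N div t \<le> card (runner t {..<N} i)" unfolding card by simp
  have "card ?K \<le> card {..N div t}" using sub by (intro card_mono) auto
  then show "card (runner t {..<N} i) \<le> Suc (N div t)" unfolding card by simp
qed

lemma runner_density:
  assumes "i < t"
  shows "(\<lambda>N. real (card (runner t {..<N} i)) / real N) \<longlonglongrightarrow> 1 / real t"
proof (rule tendsto_sandwich)
  have div: "real N / real t - 1 \<le> real (N div t)" "real (N div t) \<le> real N / real t" for N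
  proof -
    have "N div t * t \<le> N" "N \<le> Suc (N div t) * t"
      using dividend_less_div_times[of t N] assms by auto
    then have "real (N div t * t) \<le> real N" "real N \<le> real (Suc (N div t) * t)"
      by (simp_all only: of_nat_le_iff)
    then show "real N / real t - 1 \<le> real (N div t)" "real (N div t) \<le> real N / real t"
      using assms by (auto simp: field_simps)
  qed
  have bound: "real N / real t - 1 \<le> real (card (runner t {..<N} i))"
    "real (card (runner t {..<N} i)) \<le> real N / real t + 1" for N
    using card_runner_lessThan[OF assms, of N] div[of N] by linarith+
  show "\<forall>\<^sub>F N in sequentially. 1 / real t - 1 / real N \<le> real (card (runner t {..<N} i)) / real N"
  proof (rule eventually_sequentiallyI[of 1])
    fix N :: nat assume "1 \<le> N"
    then show "1 / real t - 1 / real N \<le> real (card (runner t {..<N} i)) / real N"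
      using divide_right_mono[OF bound(1)[of N], of "real N"] by (simp add: diff_divide_distrib)
  qed
  show "\<forall>\<^sub>F N in sequentially. real (card (runner t {..<N} i)) / real N \<le> 1 / real t + 1 / real N"
  proof (rule eventually_sequentiallyI[of 1])
    fix N :: nat assume "1 \<le> N"
    then show "real (card (runner t {..<N} i)) / real N \<le> 1 / real t + 1 / real N"
      using divide_right_mono[OF bound(2)[of N], of "real N"] by (simp add: add_divide_distrib)
  qed
  show "(\<lambda>N. 1 / real t - 1 / real N) \<longlonglongrightarrow> 1 / real t"
    using tendsto_diff[OF tendsto_const lim_const_over_n[of 1], of "1 / real t"] by simp
  show "(\<lambda>N. 1 / real t + 1 / real N) \<longlonglongrightarrow> 1 / real t"
    using tendsto_add[OF tendsto_const lim_const_over_n[of 1], of "1 / real t"] by simp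
qed

text \<open>The binomial coefficient is a falling product of \<open>a\<close> factors over
  \<open>a!\<close>. Spreading \<open>N ^ a\<close> over the factors gives
  \<open>(c N - i) / N\<close>, each of which tends to \<open>p\<close>.\<close>

lemma binomial_over_power_tendsto:
  assumes "(\<lambda>N. real (c N) / real N) \<longlonglongrightarrow> p"
  shows "(\<lambda>N. real (c N choose a) / real N ^ a) \<longlonglongrightarrow> p ^ a / fact a"
proof -
  have "(\<lambda>N. (\<Prod>i<a. real (c N) / real N - real i / real N) / fact a) \<longlonglongrightarrow> (\<Prod>i<a. p - 0) / fact a"
    by (intro tendsto_intros assms lim_const_over_n) simp
  moreover have "real (c N choose a) / real N ^ a =
      (\<Prod>i<a. real (c N) / real N - real i / real N) / fact a" for N
    by (simp add: binomial_gbinomial gbinomial_prod_rev prod_dividef lessThan_atLeast0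
        flip: diff_divide_distrib)
  ultimately show ?thesis by simp
qed

lemma core_probability_tendsto:
  assumes \<rho>: "\<rho> \<in> cores_in_box t r (r * t)" and r: "1 \<le> r" and t: "1 \<le> t"
  shows "(\<lambda>s. real (card {l \<in> partitions_in_box r s. core t l = \<rho>}) / real (card (partitions_in_box r s)))
    \<longlonglongrightarrow> multinomial r t (\<lambda>i. ones (abacus_word t r (r * t) \<rho> i)) / real t ^ r"
proof -
  define a where "a i = card (runner t (beads r \<rho>) i)" for i
  define n where "n N i = card (runner t {..<N} i)" for N i
  have box: "\<rho> \<in> partitions_in_box r (r * t)" using \<rho> by (simp add: cores_in_box_def)
  then have "is_partition \<rho>" by (simp add: partitions_in_box_def)
  \<comment> \<open>This identity lets the powers \<open>N ^ a i\<close> of the numerator combine to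
    the \<open>N ^ r\<close> of the denominator, and likewise for the powers of \<open>t\<close> in
    the limit.\<close>
  then have sum_a: "(\<Sum>i<t. a i) = r"
    using card_eq_sum_runner[of "beads r \<rho>" t] t by (simp add: a_def card_beads)
  have total: "card (partitions_in_box r s) = (r + s) choose r" for s
    using bij_betw_same_card[OF bij_betw_beads[OF r, of s]] by (simp add: n_subsets)
  have "(\<lambda>N. \<Prod>i<t. real (n N i choose a i) / real N ^ a i)
      \<longlonglongrightarrow> (\<Prod>i<t. (1 / real t) ^ a i / fact (a i))"
    unfolding n_def by (intro tendsto_prod binomial_over_power_tendsto runner_density) simp
  moreover have "(\<lambda>N. real N / real N) \<longlonglongrightarrow> 1"
    by (rule tendsto_eventually, rule eventually_sequentiallyI[of 1]) simp
  then have "(\<lambda>N. real (N choose r) / real N ^ r) \<longlonglongrightarrow> 1 ^ r / fact r"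
    by (rule binomial_over_power_tendsto)
  ultimately have "(\<lambda>N. (\<Prod>i<t. real (n N i choose a i) / real N ^ a i) / (real (N choose r) / real N ^ r))
      \<longlonglongrightarrow> (\<Prod>i<t. (1 / real t) ^ a i / fact (a i)) / (1 ^ r / fact r)"
    by (rule tendsto_divide) simp
  also have "(\<Prod>i<t. (1 / real t) ^ a i / fact (a i)) / (1 ^ r / fact r) =
      multinomial r t a / real t ^ r"
  proof -
    have "(\<Prod>i<t. real t ^ a i) = real t ^ r"
      using sum_a by (simp only: power_sum[symmetric])
    then show ?thesis
      by (simp add: multinomial_def prod_dividef power_one_over prod.distrib mult.commute)
  qed
  also have "multinomial r t a = multinomial r t (\<lambda>i. ones (abacus_word t r (r * t) \<rho> i))"
    unfolding multinomial_def using ones_abacus_word[OF box r] by (simp add: a_def)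
  \<comment> \<open>The limit was taken in the number \<open>N\<close> of bead positions; here
    \<open>N = s + r\<close>.\<close>
  finally have lim: "(\<lambda>s. (\<Prod>i<t. real (n (s + r) i choose a i) / real (s + r) ^ a i) /
      (real ((s + r) choose r) / real (s + r) ^ r))
      \<longlonglongrightarrow> multinomial r t (\<lambda>i. ones (abacus_word t r (r * t) \<rho> i)) / real t ^ r"
    by (rule LIMSEQ_ignore_initial_segment)
  have "real (card {l \<in> partitions_in_box r s. core t l = \<rho>}) / real (card (partitions_in_box r s)) =
      (\<Prod>i<t. real (n (s + r) i choose a i) / real (s + r) ^ a i) /
      (real ((s + r) choose r) / real (s + r) ^ r)" for s
  proof -
    have "(\<Prod>i<t. real (s + r) ^ a i) = real (s + r) ^ r"
      using sum_a by (simp only: power_sum[symmetric])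
    moreover have "real (s + r) ^ r \<noteq> 0" using r by simp
    ultimately show ?thesis
      unfolding card_core_fibre[OF \<rho> r t] total prod_dividef
      by (simp add: n_def a_def add.commute)
  qed
  with lim show ?thesis by presburger
qed

section \<open>Coefficients of the generating functions\<close>

text \<open>The event is split according to the core. By \<open>core_in_box\<close> the cores range
  over a finite set that does not vary with \<open>s\<close>.\<close>

lemma core_size_pgf_nth:
  assumes r: "1 \<le> r" and t: "1 \<le> t"
  shows "fps_nth (core_size_pgf t r s) n =
    (\<Sum>\<rho> \<in> {\<rho> \<in> cores_in_box t r (r * t). sum_list \<rho> = n}.
       real (card {l \<in> partitions_in_box r s. core t l = \<rho>}) / real (card (partitions_in_box r s)))"
proof -
  let ?C = "{\<rho> \<in> cores_in_box t r (r * t). sum_list \<rho> = n}"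
  let ?F = "\<lambda>\<rho>. {l \<in> partitions_in_box r s. core t l = \<rho>}"
  have "core t l \<in> cores_in_box t r (r * t)" if "l \<in> partitions_in_box r s" for l
    using that r t by (intro core_in_box) (auto simp: partitions_in_box_def)
  then have "partitions_in_box r s \<inter> {l. sum_list (core t l) = n} = (\<Union>\<rho>\<in>?C. ?F \<rho>)"
    by auto
  moreover have "card (\<Union>\<rho>\<in>?C. ?F \<rho>) = (\<Sum>\<rho>\<in>?C. card (?F \<rho>))"
    by (rule card_UN_disjoint) (auto simp: finite_cores_in_box finite_partitions_in_box)
  ultimately show ?thesis
    by (simp add: core_size_pgf_def measure_pmf_of_set finite_partitions_in_box
        partitions_in_box_nonempty sum_divide_distrib)
qed

theorem proposition5p1:
  fixes r t :: nat
  assumes "r \<ge> 1" and "t \<ge> 2"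
  shows "\<forall>n. (\<lambda>s. fps_nth (core_size_pgf t r s) n) \<longlonglongrightarrow> fps_nth (limit_pgf t r) n"
proof
  fix n
  let ?C = "{\<rho> \<in> cores_in_box t r (r * t). sum_list \<rho> = n}"
  let ?m = "\<lambda>\<rho>. multinomial r t (\<lambda>i. ones (abacus_word t r (r * t) \<rho> i)) / real t ^ r"
  have t: "1 \<le> t" using assms(2) by simp
  have "fps_nth (limit_pgf t r) n =
      (\<Sum>\<rho>\<in>cores_in_box t r (r * t). if sum_list \<rho> = n then ?m \<rho> else 0)"
    unfolding limit_pgf_def fps_sum_nth
    by (intro sum.cong) (auto simp: fps_mult_left_const_nth fps_X_power_nth)
  also have "\<dots> = (\<Sum>\<rho>\<in>?C. ?m \<rho>)"
    by (simp add: sum.inter_filter finite_cores_in_box)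
  finally have limit: "fps_nth (limit_pgf t r) n = (\<Sum>\<rho>\<in>?C. ?m \<rho>)" .
  \<comment> \<open>The index set is the same for every \<open>s\<close>, so the limit passes to
    each term.\<close>
  show "(\<lambda>s. fps_nth (core_size_pgf t r s) n) \<longlonglongrightarrow> fps_nth (limit_pgf t r) n"
    unfolding core_size_pgf_nth[OF assms(1) t] limit
    using core_probability_tendsto[OF _ assms(1) t] by (intro tendsto_sum) auto
qed

end
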